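(* There is a countable rigid (i.e. with trivial automorphism group) elementarily indivisible structure in a finite relational language.
   Context: A structure $\mathcal{M}$ in a relational language is elementarily indivisible if for every coloring of its universe in two colors there is a monochromatic substructure $\mathcal{M}'\subseteq\mathcal{M}$ such that $\mathcal{M}'\cong\mathcal{M}$ and $\mathcal{M}'$ is an elementary substructure of $\mathcal{M}$. *)

theory Defs
  imports Main "HOL-Library.Countable_Set"
begin

record 'r language =
  symbols :: "'r set"
  arity :: "'r \<Rightarrow> nat"

definition finite_relational_language :: "'r language \<Rightarrow> bool" where
  "finite_relational_language L \<longleftrightarrow> finite (symbols L) \<and> (\<forall>r\<in>symbols L. 0 < arity L r)"

text \<open>First-order formulas with equality; variables are natural numbers. The remaining
  connectives and the universal quantifier are definable.\<close>

datatype 'r formula =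
    Eq nat nat
  | Rel 'r "nat list"
  | Neg "'r formula"
  | Conj "'r formula" "'r formula"
  | Exi nat "'r formula"

primrec formula_of :: "'r language \<Rightarrow> 'r formula \<Rightarrow> bool" where
  "formula_of L (Eq x y) \<longleftrightarrow> True"
| "formula_of L (Rel r xs) \<longleftrightarrow> r \<in> symbols L \<and> length xs = arity L r"
| "formula_of L (Neg p) \<longleftrightarrow> formula_of L p"
| "formula_of L (Conj p q) \<longleftrightarrow> formula_of L p \<and> formula_of L q"
| "formula_of L (Exi x p) \<longleftrightarrow> formula_of L p"

record ('r, 'a) struct =
  univ :: "'a set"
  interp :: "'r \<Rightarrow> 'a list set"

definition tuples :: "nat \<Rightarrow> 'a set \<Rightarrow> 'a list set" where
  "tuples n A = {xs. length xs = n \<and> set xs \<subseteq> A}"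

definition structure_of :: "'r language \<Rightarrow> ('r, 'a) struct \<Rightarrow> bool" where
  "structure_of L M \<longleftrightarrow>
     univ M \<noteq> {} \<and> (\<forall>r\<in>symbols L. interp M r \<subseteq> tuples (arity L r) (univ M))"

primrec sat :: "('r, 'a) struct \<Rightarrow> (nat \<Rightarrow> 'a) \<Rightarrow> 'r formula \<Rightarrow> bool" where
  "sat M s (Eq x y) \<longleftrightarrow> s x = s y"
| "sat M s (Rel r xs) \<longleftrightarrow> map s xs \<in> interp M r"
| "sat M s (Neg p) \<longleftrightarrow> \<not> sat M s p"
| "sat M s (Conj p q) \<longleftrightarrow> sat M s p \<and> sat M s q"
| "sat M s (Exi x p) \<longleftrightarrow> (\<exists>a\<in>univ M. sat M (s(x := a)) p)"

definition substructure :: "'r language \<Rightarrow> ('r, 'a) struct \<Rightarrow> ('r, 'a) struct \<Rightarrow> bool" where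
  "substructure L N M \<longleftrightarrow>
     structure_of L N \<and> structure_of L M \<and> univ N \<subseteq> univ M \<and>
     (\<forall>r\<in>symbols L. interp N r = interp M r \<inter> tuples (arity L r) (univ N))"

definition elementary_substructure ::
    "'r language \<Rightarrow> ('r, 'a) struct \<Rightarrow> ('r, 'a) struct \<Rightarrow> bool" where
  "elementary_substructure L N M \<longleftrightarrow>
     substructure L N M \<and>
     (\<forall>p s. formula_of L p \<longrightarrow> range s \<subseteq> univ N \<longrightarrow> (sat N s p \<longleftrightarrow> sat M s p))"

definition isomorphism ::
    "'r language \<Rightarrow> ('r, 'a) struct \<Rightarrow> ('r, 'b) struct \<Rightarrow> ('a \<Rightarrow> 'b) \<Rightarrow> bool" where
  "isomorphism L M N f \<longleftrightarrow>
     bij_betw f (univ M) (univ N) \<and>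
     (\<forall>r\<in>symbols L. \<forall>xs\<in>tuples (arity L r) (univ M).
        xs \<in> interp M r \<longleftrightarrow> map f xs \<in> interp N r)"

definition isomorphic :: "'r language \<Rightarrow> ('r, 'a) struct \<Rightarrow> ('r, 'b) struct \<Rightarrow> bool" where
  "isomorphic L M N \<longleftrightarrow> (\<exists>f. isomorphism L M N f)"

abbreviation automorphism :: "'r language \<Rightarrow> ('r, 'a) struct \<Rightarrow> ('a \<Rightarrow> 'a) \<Rightarrow> bool" where
  "automorphism L M \<equiv> isomorphism L M M"

text \<open>Automorphisms are total HOL functions, so only their values on the universe matter.\<close>

definition rigid :: "'r language \<Rightarrow> ('r, 'a) struct \<Rightarrow> bool" where
  "rigid L M \<longleftrightarrow> (\<forall>f. automorphism L M f \<longrightarrow> (\<forall>x\<in>univ M. f x = x))"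

definition monochromatic :: "('a \<Rightarrow> 'c) \<Rightarrow> ('r, 'a) struct \<Rightarrow> bool" where
  "monochromatic c N \<longleftrightarrow> (\<exists>k. \<forall>x\<in>univ N. c x = k)"

definition elementarily_indivisible :: "'r language \<Rightarrow> ('r, 'a) struct \<Rightarrow> bool" where
  "elementarily_indivisible L M \<longleftrightarrow>
     (\<forall>c :: 'a \<Rightarrow> bool. \<exists>N. substructure L N M \<and> monochromatic c N \<and>
        isomorphic L N M \<and> elementary_substructure L N M)"

end

theory Submission
  imports Defs
begin

text \<open>On the vertex set \<open>nat\<close> we put a generic colouring of pairs together with a generic family of
  tournaments, one for each class of colours. The classes of finite size are definable by their size;
  for \<open>x < y\<close> all but finitely many of their tournaments contain the arc from \<open>x\<close> to \<open>y\<close>. Hence every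
  automorphism preserves the order of \<open>nat\<close> and is trivial. Formulas with few variables cannot
  tell large finite classes from infinite ones, and the tournaments of the infinite classes are
  unconstrained; so up to first-order equivalence the order is invisible, and a new vertex lying above
  all others can realise every type. This gives elimination of quantifiers, by which every
  order-preserving self-embedding respecting colours and tournaments is elementary; such embeddings
  into one colour class of a partition of \<open>nat\<close> are built greedily, as for the random graph.\<close>

section \<open>Preliminaries\<close>

text \<open>Used to turn correspondences between vertices into maps on colours and classes:
  well-definedness is enough, since \<open>inv_into\<close> picks a representative in each
  fibre.\<close>

lemma factor_through:
  assumes "\<And>p p'. p \<in> P \<Longrightarrow> p' \<in> P \<Longrightarrow> f p = f p' \<Longrightarrow> g p = g p'"
  obtains h where "\<And>p. p \<in> P \<Longrightarrow> h (f p) = g p"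
proof
  fix p assume "p \<in> P"
  then have "inv_into P f (f p) \<in> P" "f (inv_into P f (f p)) = f p"
    by (auto intro: inv_into_into f_inv_into_f)
  then show "(\<lambda>u. g (inv_into P f u)) (f p) = g p"
    using assms \<open>p \<in> P\<close> by blast
qed

lemma factor_through2:
  assumes "\<And>x y x' y'. x \<in> A \<Longrightarrow> y \<in> A \<Longrightarrow> x' \<in> A \<Longrightarrow> y' \<in> A \<Longrightarrow>
    f x y = f x' y' \<Longrightarrow> g x y = g x' y'"
  obtains h where "\<And>x y. x \<in> A \<Longrightarrow> y \<in> A \<Longrightarrow> h (f x y) = g x y"
proof -
  obtain h where h: "\<And>p. p \<in> A \<times> A \<Longrightarrow> h (case_prod f p) = case_prod g p"
  proof (rule factor_through)
    fix p p' assume p: "p \<in> A \<times> A" "p' \<in> A \<times> A" "case_prod f p = case_prod f p'"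
    obtain x y x' y' where "p = (x, y)" "p' = (x', y')" by (cases p, cases p')
    then show "case_prod g p = case_prod g p'"
      using p assms[of x y x' y'] by simp
  qed (rule that)
  show thesis
    by (rule that[of h]) (use h[of "(x, y)" for x y] in simp)
qed

lemma inj_on_fun_upd_insert:
  assumes "inj_on f A" "y \<notin> f ` A" "x \<notin> A"
  shows "inj_on (f(x := y)) (insert x A)"
proof -
  have "(f(x := y)) ` A = f ` A"
    using assms(3) by (auto simp: image_def)
  then show ?thesis
    using assms by (simp add: inj_on_insert inj_on_fun_updI)
qed

lemma isomorphism_inv_into:
  assumes "isomorphism L M N f"
  shows "isomorphism L N M (inv_into (univ M) f)"
  unfolding isomorphism_def
proof (intro conjI ballI)
  let ?g = "inv_into (univ M) f"
  have bij: "bij_betw f (univ M) (univ N)"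
    using assms by (simp add: isomorphism_def)
  then show bij': "bij_betw ?g (univ N) (univ M)"
    by (rule bij_betw_inv_into)
  fix r xs assume r: "r \<in> symbols L" and xs: "xs \<in> tuples (arity L r) (univ N)"
  have "map ?g xs \<in> tuples (arity L r) (univ M)"
    using xs bij' by (auto simp: tuples_def bij_betw_def)
  moreover have "map f (map ?g xs) = xs"
    using xs bij by (auto simp: tuples_def bij_betw_inv_into_right intro!: map_idI)
  ultimately show "xs \<in> interp N r \<longleftrightarrow> map ?g xs \<in> interp M r"
    using assms r by (metis isomorphism_def)
qed

lemma sat_isomorphism:
  assumes iso: "isomorphism L M N f"
  shows "formula_of L p \<Longrightarrow> range s \<subseteq> univ M \<Longrightarrow> sat N (f \<circ> s) p \<longleftrightarrow> sat M s p"
proof (induction p arbitrary: s)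
  case (Eq x y)
  then have "s x \<in> univ M" "s y \<in> univ M" by auto
  moreover have "inj_on f (univ M)"
    using iso by (simp add: isomorphism_def bij_betw_def)
  ultimately show ?case by (simp add: inj_on_eq_iff)
next
  case (Rel r xs)
  then have "map s xs \<in> tuples (arity L r) (univ M)"
    by (auto simp: tuples_def)
  then show ?case
    using iso Rel by (simp add: isomorphism_def comp_def)
next
  case (Exi x p)
  have "sat N (f \<circ> s) (Exi x p) \<longleftrightarrow> (\<exists>a\<in>univ M. sat N ((f \<circ> s)(x := f a)) p)"
  proof -
    have "univ N = f ` univ M" using iso by (simp add: isomorphism_def bij_betw_def)
    then show ?thesis by simp
  qed
  also have "\<dots> \<longleftrightarrow> (\<exists>a\<in>univ M. sat N (f \<circ> s(x := a)) p)"
    by (simp add: fun_upd_comp)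
  also have "\<dots> \<longleftrightarrow> (\<exists>a\<in>univ M. sat M (s(x := a)) p)"
    using Exi by (intro bex_cong refl Exi.IH) auto
  finally show ?case by (simp add: comp_def)
qed auto

text \<open>Bound variables count as well: the back-and-forth argument fixes one finite set of
  variables, and a quantifier merely reassigns one of them.\<close>

primrec vars :: "'r formula \<Rightarrow> nat set" where
  "vars (Eq x y) = {x, y}"
| "vars (Rel r xs) = set xs"
| "vars (Neg p) = vars p"
| "vars (Conj p q) = vars p \<union> vars q"
| "vars (Exi x p) = insert x (vars p)"

lemma finite_vars: "finite (vars p)"
  by (induction p) auto

section \<open>Generic colourings\<close>

text \<open>The class \<open>Inl n\<close> consists of \<open>n + 1\<close> colours, so it can be recognised by its size;
  each class \<open>Inr z\<close> consists of infinitely many colours.\<close>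

type_synonym cls = "nat + nat"
type_synonym color = "cls \<times> nat"

fun valid :: "color \<Rightarrow> bool" where
  "valid (Inl n, i) \<longleftrightarrow> i \<le> n"
| "valid (Inr z, i) \<longleftrightarrow> True"

text \<open>The order of the vertices is recovered from the sets \<open>{n. Inl n \<in> t x y}\<close>, which are cofinite
  for \<open>x < y\<close> and finite otherwise. First-order logic cannot tell the classes \<open>Inl n\<close> with large \<open>n\<close>
  from the classes \<open>Inr z\<close>, on which \<open>t\<close> is unconstrained.\<close>

locale generic_coloring =
  fixes c :: "nat \<Rightarrow> nat \<Rightarrow> color" and t :: "nat \<Rightarrow> nat \<Rightarrow> cls set"
  assumes c_sym: "c x y = c y x"
    and c_diag: "c x x = (Inl 0, 0)"
    and c_valid: "valid (c x y)"
    and c_bound: "x < y \<Longrightarrow> fst (c x y) = Inr z \<Longrightarrow> z < y"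
    and t_diag: "t x x = {}"
    and t_flip: "x \<noteq> y \<Longrightarrow> t y x = - t x y"
    and t_cofinite: "x < y \<Longrightarrow> finite {n. Inl n \<notin> t x y}"
    and class_ext: "\<exists>z\<ge>N. \<forall>y<N. \<forall>x<y. Inr z \<in> t x y \<longleftrightarrow> (x, y) \<in> R"
    and vertex_ext: "(\<And>x. valid (k x)) \<Longrightarrow> (\<And>x. finite {n. Inl n \<notin> D x}) \<Longrightarrow>
      \<exists>y\<ge>N. \<forall>x<N. c x y = k x \<and> (\<forall>n. Inl n \<in> t x y \<longleftrightarrow> Inl n \<in> D x) \<and>
        (\<forall>z<N. Inr z \<in> t x y \<longleftrightarrow> Inr z \<in> D x)"

section \<open>Existence of a generic colouring\<close>

definition repeat_enum :: "nat \<Rightarrow> 'a::countable" where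
  "repeat_enum j = from_nat (fst (prod_decode j))"

lemma repeat_enum_unbounded: "\<exists>j\<ge>N. repeat_enum j = (u :: 'a::countable)"
  by (intro exI[of _ "prod_encode (to_nat u, N)"]) (simp add: repeat_enum_def le_prod_encode_2)

text \<open>For \<open>i < j\<close>, vertex \<open>j\<close> is a code for the colour of \<open>{i, j}\<close> and for \<open>t i j\<close>
  on all classes except those \<open>Inr z\<close> with \<open>z \<ge> j\<close>, for which \<open>z\<close> is a code for the pairs concerned.\<close>

definition code_color :: "nat \<Rightarrow> nat \<Rightarrow> color" where
  "code_color i j =
     (let l = repeat_enum j :: (color \<times> cls list) list; k = fst (l ! i)
      in if i < length l \<and> valid k \<and> (\<forall>z. fst k = Inr z \<longrightarrow> z < j) then k else (Inl 0, 0))"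

definition code_set :: "nat \<Rightarrow> nat \<Rightarrow> cls set" where
  "code_set i j =
     (let l = repeat_enum j :: (color \<times> cls list) list;
          E = (if i < length l then set (snd (l ! i)) else {})
      in {Inl n | n. Inl n \<notin> E} \<union>
         {Inr z | z. if z < j then Inr z \<in> E else (i, j) \<in> set (repeat_enum z)})"

lemma exists_generic_coloring: "\<exists>c t. generic_coloring c t"
proof -
  define c where "c x y = (if x < y then code_color x y else if y < x then code_color y x
    else (Inl 0, 0))" for x y
  define t where "t x y = (if x < y then code_set x y else if y < x then - code_set y x
    else {})" for x y
  have code_set_Inl: "finite {n. Inl n \<notin> code_set i j}" for i j
  proof -
    have "finite (Inl -` set xs)" for xs :: "cls list"
      by (intro finite_vimageI) auto
    then have "finite {n. Inl n \<in> set xs}" for xs :: "cls list"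
      by (simp add: vimage_def)
    then show ?thesis
      by (auto simp: code_set_def Let_def)
  qed
  have "generic_coloring c t"
  proof
    fix N :: nat and R :: "(nat \<times> nat) set"
    have "finite {(x, y). (x, y) \<in> R \<and> x < N \<and> y < N}"
      by (rule finite_subset[of _ "{..<N} \<times> {..<N}"]) auto
    then obtain l where l: "set l = {(x, y). (x, y) \<in> R \<and> x < N \<and> y < N}"
      using finite_list by blast
    obtain z where z: "z \<ge> N" "repeat_enum z = l"
      using repeat_enum_unbounded by blast
    then show "\<exists>z\<ge>N. \<forall>y<N. \<forall>x<y. Inr z \<in> t x y \<longleftrightarrow> (x, y) \<in> R"
      by (intro exI[of _ z]) (auto simp: t_def code_set_def Let_def l)
  next
    fix N :: nat and k :: "nat \<Rightarrow> color" and D :: "nat \<Rightarrow> cls set"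
    assume k: "\<And>x. valid (k x)" and D: "\<And>x. finite {n. Inl n \<notin> D x}"
    \<comment> \<open>The list names the finitely many finite-size classes outside
      \<open>D x\<close> but the infinite classes inside it, matching the opposite conventions of
      \<open>code_set\<close> for the two kinds.\<close>
    have "\<exists>l. set l = Inl ` {n. Inl n \<notin> D x} \<union> Inr ` {z. z < N \<and> Inr z \<in> D x}" for x
      by (rule finite_list) (simp add: D)
    then obtain e where e:
        "\<And>x. set (e x) = Inl ` {n. Inl n \<notin> D x} \<union> Inr ` {z. z < N \<and> Inr z \<in> D x}"
      by metis
    \<comment> \<open>A vertex \<open>y\<close> beyond \<open>B\<close> exceeds the index of every
      infinite class prescribed by \<open>k\<close>, so it passes the test in
      \<open>code_color\<close> that secures \<open>c_bound\<close>.\<close>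
    obtain B where B: "\<And>x z. x < N \<Longrightarrow> fst (k x) = Inr z \<Longrightarrow> z < B"
    proof -
      have "finite (Inr -` (\<lambda>x. fst (k x)) ` {..<N})"
        by (intro finite_vimageI) auto
      then obtain B where "\<forall>z\<in>Inr -` (\<lambda>x. fst (k x)) ` {..<N}. z < B"
        using finite_nat_set_iff_bounded by blast
      then show thesis
        by (intro that[of B]) (metis image_eqI lessThan_iff vimageI)
    qed
    obtain y where y: "y \<ge> max N B" "repeat_enum y = map (\<lambda>x. (k x, e x)) [0..<N]"
      using repeat_enum_unbounded by blast
    have "c x y = k x \<and> (\<forall>n. Inl n \<in> t x y \<longleftrightarrow> Inl n \<in> D x) \<and>
        (\<forall>z<N. Inr z \<in> t x y \<longleftrightarrow> Inr z \<in> D x)" if x: "x < N" for x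
    proof -
      have "\<forall>z. fst (k x) = Inr z \<longrightarrow> z < y"
        using B[OF x] y(1) by fastforce
      then have "c x y = k x"
        using x y k by (simp add: c_def code_color_def Let_def)
      moreover have "(\<forall>n. Inl n \<in> t x y \<longleftrightarrow> Inl n \<in> D x) \<and> (\<forall>z<N. Inr z \<in> t x y \<longleftrightarrow> Inr z \<in> D x)"
        using x y by (auto simp: t_def code_set_def Let_def e)
      ultimately show ?thesis by blast
    qed
    then show "\<exists>y\<ge>N. \<forall>x<N. c x y = k x \<and> (\<forall>n. Inl n \<in> t x y \<longleftrightarrow> Inl n \<in> D x) \<and>
        (\<forall>z<N. Inr z \<in> t x y \<longleftrightarrow> Inr z \<in> D x)"
      using y(1) by (intro exI[of _ y]) auto
  qed (auto simp: c_def t_def code_color_def Let_def code_set_Inl split: if_splits)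
  then show ?thesis by blast
qed

section \<open>The relational structure of a generic colouring\<close>

definition coloring_language :: "nat language" where
  "coloring_language = \<lparr>symbols = {0, 1, 2}, arity = \<lambda>_. 4\<rparr>"

context generic_coloring
begin

text \<open>Colours and classes are not elements of the structure: a pair of vertices stands for its
  colour and for the class of that colour. Three quaternary relations thus handle infinitely many
  colours and tournaments.\<close>

definition coloring_rel :: "nat \<Rightarrow> nat list set" where
  "coloring_rel r = {[x, y, z, w] | x y z w.
     if r = 0 then c x y = c z w
     else if r = 1 then fst (c x y) = fst (c z w)
     else fst (c z w) \<in> t x y}"

lemma length_coloring_rel: "xs \<in> coloring_rel r \<Longrightarrow> length xs = 4"
  unfolding coloring_rel_def by (elim CollectE exE conjE, hypsubst) (simp (no_asm))

definition coloring_struct :: "(nat, nat) struct" where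
  "coloring_struct = \<lparr>univ = UNIV, interp = coloring_rel\<rparr>"

lemma coloring_rel_iff:
  "[x, y, z, w] \<in> coloring_rel 0 \<longleftrightarrow> c x y = c z w"
  "[x, y, z, w] \<in> coloring_rel 1 \<longleftrightarrow> fst (c x y) = fst (c z w)"
  "[x, y, z, w] \<in> coloring_rel 2 \<longleftrightarrow> fst (c z w) \<in> t x y"
  by (simp_all add: coloring_rel_def)

lemma structure_of_coloring: "structure_of coloring_language coloring_struct"
  using length_coloring_rel
  by (auto simp: structure_of_def coloring_language_def coloring_struct_def tuples_def)

section \<open>Finite-variable elimination of quantifiers\<close>

text \<open>Beyond the atomic formulas, the classes \<open>Inl n\<close> with \<open>n < q\<close>
  are compared by name, although no symbol denotes them: they may be too small to offer a spare
  colour when a vertex is added.\<close>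

definition equiv_on :: "nat set \<Rightarrow> nat \<Rightarrow> (nat \<Rightarrow> nat) \<Rightarrow> (nat \<Rightarrow> nat) \<Rightarrow> bool" where
  "equiv_on V q s s' \<longleftrightarrow> (\<forall>i\<in>V. \<forall>j\<in>V.
     (s i = s j \<longleftrightarrow> s' i = s' j) \<and>
     (\<forall>n<q. Inl n \<in> t (s i) (s j) \<longleftrightarrow> Inl n \<in> t (s' i) (s' j)) \<and>
     (\<forall>n<q. fst (c (s i) (s j)) = Inl n \<longleftrightarrow> fst (c (s' i) (s' j)) = Inl n) \<and>
     (\<forall>k\<in>V. \<forall>l\<in>V.
       (c (s i) (s j) = c (s k) (s l) \<longleftrightarrow> c (s' i) (s' j) = c (s' k) (s' l)) \<and>
       (fst (c (s i) (s j)) = fst (c (s k) (s l)) \<longleftrightarrow>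
         fst (c (s' i) (s' j)) = fst (c (s' k) (s' l))) \<and>
       (fst (c (s k) (s l)) \<in> t (s i) (s j) \<longleftrightarrow> fst (c (s' k) (s' l)) \<in> t (s' i) (s' j))))"

lemma equiv_onD:
  assumes "equiv_on V q s s'" "i \<in> V" "j \<in> V"
  shows "s i = s j \<longleftrightarrow> s' i = s' j"
    and "n < q \<Longrightarrow> Inl n \<in> t (s i) (s j) \<longleftrightarrow> Inl n \<in> t (s' i) (s' j)"
    and "n < q \<Longrightarrow> fst (c (s i) (s j)) = Inl n \<longleftrightarrow> fst (c (s' i) (s' j)) = Inl n"
    and "k \<in> V \<Longrightarrow> l \<in> V \<Longrightarrow>
      c (s i) (s j) = c (s k) (s l) \<longleftrightarrow> c (s' i) (s' j) = c (s' k) (s' l)"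
    and "k \<in> V \<Longrightarrow> l \<in> V \<Longrightarrow> fst (c (s i) (s j)) = fst (c (s k) (s l)) \<longleftrightarrow>
      fst (c (s' i) (s' j)) = fst (c (s' k) (s' l))"
    and "k \<in> V \<Longrightarrow> l \<in> V \<Longrightarrow>
      fst (c (s k) (s l)) \<in> t (s i) (s j) \<longleftrightarrow> fst (c (s' k) (s' l)) \<in> t (s' i) (s' j)"
proof -
  note eq = bspec[OF bspec[OF assms(1)[unfolded equiv_on_def] assms(2)] assms(3)]
  show "s i = s j \<longleftrightarrow> s' i = s' j"
    by (rule eq[THEN conjunct1])
  show "n < q \<Longrightarrow> Inl n \<in> t (s i) (s j) \<longleftrightarrow> Inl n \<in> t (s' i) (s' j)"
    by (rule eq[THEN conjunct2, THEN conjunct1, rule_format])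
  show "n < q \<Longrightarrow> fst (c (s i) (s j)) = Inl n \<longleftrightarrow> fst (c (s' i) (s' j)) = Inl n"
    by (rule eq[THEN conjunct2, THEN conjunct2, THEN conjunct1, rule_format])
  assume kl: "k \<in> V" "l \<in> V"
  note eq' = bspec[OF bspec[OF eq[THEN conjunct2, THEN conjunct2, THEN conjunct2] kl(1)] kl(2)]
  show "c (s i) (s j) = c (s k) (s l) \<longleftrightarrow> c (s' i) (s' j) = c (s' k) (s' l)"
    by (rule eq'[THEN conjunct1])
  show "fst (c (s i) (s j)) = fst (c (s k) (s l)) \<longleftrightarrow>
      fst (c (s' i) (s' j)) = fst (c (s' k) (s' l))"
    by (rule eq'[THEN conjunct2, THEN conjunct1])
  show "fst (c (s k) (s l)) \<in> t (s i) (s j) \<longleftrightarrow> fst (c (s' k) (s' l)) \<in> t (s' i) (s' j)"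
    by (rule eq'[THEN conjunct2, THEN conjunct2])
qed

lemma equiv_on_sym:
  assumes "equiv_on V q s s'"
  shows "equiv_on V q s' s"
  unfolding equiv_on_def
  by (intro ballI conjI allI impI; rule equiv_onD[OF assms, symmetric]; assumption)

lemma equiv_on_mono:
  assumes "equiv_on V q s s'" "W \<subseteq> V"
  shows "equiv_on W q s s'"
  unfolding equiv_on_def
  by (intro ballI conjI allI impI; rule equiv_onD[OF assms(1)])
    (auto intro: subsetD[OF assms(2)])

lemma equiv_on_comp:
  assumes "equiv_on W q s s'" "\<rho> ` V \<subseteq> W"
  shows "equiv_on V q (s \<circ> \<rho>) (s' \<circ> \<rho>)"
  unfolding equiv_on_def comp_def
  by (intro ballI conjI allI impI; rule equiv_onD[OF assms(1)])
    (auto intro: subsetD[OF assms(2)])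

text \<open>Injective maps preserve and reflect the equalities of colours and classes that
  \<open>equiv_on\<close> compares. The small classes belong to \<open>Z\<close> even if no colour
  of \<open>F\<close> lies in them, because their tournaments are compared too.\<close>

lemma equiv_on_transport:
  assumes inj_s: "\<And>i j. i \<in> V \<Longrightarrow> j \<in> V \<Longrightarrow> s i = s j \<longleftrightarrow> s' i = s' j"
    and c: "\<And>i j. i \<in> V \<Longrightarrow> j \<in> V \<Longrightarrow> c (s' i) (s' j) = \<theta> (c (s i) (s j))"
    and t: "\<And>i j z. i \<in> V \<Longrightarrow> j \<in> V \<Longrightarrow> z \<in> Z \<Longrightarrow> \<mu> z \<in> t (s' i) (s' j) \<longleftrightarrow> z \<in> t (s i) (s j)"
    and F: "\<And>i j. i \<in> V \<Longrightarrow> j \<in> V \<Longrightarrow> c (s i) (s j) \<in> F"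
    and Z: "fst ` F \<subseteq> Z" "Inl ` {..<q} \<subseteq> Z"
    and inj: "inj_on \<theta> F" "inj_on \<mu> Z"
    and fst: "\<And>u. u \<in> F \<Longrightarrow> fst (\<theta> u) = \<mu> (fst u)"
    and small: "\<And>n. n < q \<Longrightarrow> \<mu> (Inl n) = Inl n"
  shows "equiv_on V q s s'"
  unfolding equiv_on_def
proof (intro ballI conjI allI impI)
  fix i j assume ij: "i \<in> V" "j \<in> V"
  have cF: "fst (c (s k) (s l)) \<in> Z" "fst (c (s' k) (s' l)) = \<mu> (fst (c (s k) (s l)))"
    if "k \<in> V" "l \<in> V" for k l
    using F[OF that] Z(1) fst[OF F[OF that]] c[OF that] by auto
  show "s i = s j \<longleftrightarrow> s' i = s' j"
    using ij by (rule inj_s)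
  fix n assume n: "n < q"
  then have nZ: "Inl n \<in> Z" using Z by auto
  show "Inl n \<in> t (s i) (s j) \<longleftrightarrow> Inl n \<in> t (s' i) (s' j)"
    using t[OF ij nZ] small[OF n] by simp
  show "fst (c (s i) (s j)) = Inl n \<longleftrightarrow> fst (c (s' i) (s' j)) = Inl n"
    using cF[OF ij] nZ small[OF n] inj(2) by (metis inj_on_eq_iff)
next
  fix i j k l assume ij: "i \<in> V" "j \<in> V" and kl: "k \<in> V" "l \<in> V"
  have cF: "fst (c (s k) (s l)) \<in> Z" "fst (c (s' k) (s' l)) = \<mu> (fst (c (s k) (s l)))"
    if "k \<in> V" "l \<in> V" for k l
    using F[OF that] Z(1) fst[OF F[OF that]] c[OF that] by auto
  show "c (s i) (s j) = c (s k) (s l) \<longleftrightarrow> c (s' i) (s' j) = c (s' k) (s' l)"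
    using c[OF ij] c[OF kl] inj(1) F[OF ij] F[OF kl] by (simp add: inj_on_eq_iff)
  show "fst (c (s i) (s j)) = fst (c (s k) (s l)) \<longleftrightarrow>
         fst (c (s' i) (s' j)) = fst (c (s' k) (s' l))"
    using cF[OF ij] cF[OF kl] inj(2) by (simp add: inj_on_eq_iff)
  show "fst (c (s k) (s l)) \<in> t (s i) (s j) \<longleftrightarrow> fst (c (s' k) (s' l)) \<in> t (s' i) (s' j)"
    using cF[OF kl] t[OF ij] by simp
qed

text \<open>Classes without an image yet are sent one by one to infinite classes with fresh indices,
  where \<open>class_ext\<close> supplies any tournament on an initial segment. A large finite class
  may thus become infinite, a change that formulas with few variables do not detect.\<close>

lemma class_map_extend:
  assumes "finite Z1" "finite Z0" "inj_on \<mu> Z0"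
  shows "\<exists>\<mu>'. (\<forall>z\<in>Z0. \<mu>' z = \<mu> z) \<and> inj_on \<mu>' (Z0 \<union> Z1) \<and>
    (\<forall>z\<in>Z1 - Z0. \<exists>w. \<mu>' z = Inr w \<and> (\<forall>y<N. \<forall>x<y. Inr w \<in> t x y \<longleftrightarrow> (x, y) \<in> R z))"
  using assms(1)
proof induction
  case empty
  then show ?case using assms by auto
next
  case (insert z Z1)
  then obtain \<mu>' where \<mu>': "\<forall>z\<in>Z0. \<mu>' z = \<mu> z" "inj_on \<mu>' (Z0 \<union> Z1)"
    "\<forall>z\<in>Z1 - Z0. \<exists>w. \<mu>' z = Inr w \<and> (\<forall>y<N. \<forall>x<y. Inr w \<in> t x y \<longleftrightarrow> (x, y) \<in> R z)"
    by blast
  show ?case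
  proof (cases "z \<in> Z0")
    case True
    then have "Z0 \<union> insert z Z1 = Z0 \<union> Z1" "insert z Z1 - Z0 = Z1 - Z0" by auto
    then show ?thesis using \<mu>' by metis
  next
    case False
    have "finite (Inr -` \<mu>' ` (Z0 \<union> Z1))"
      using insert assms by (intro finite_vimageI) auto
    then obtain B where B: "\<forall>w\<in>Inr -` \<mu>' ` (Z0 \<union> Z1). w < B"
      using finite_nat_set_iff_bounded by blast
    obtain w where w: "w \<ge> max N B" "\<forall>y<max N B. \<forall>x<y. Inr w \<in> t x y \<longleftrightarrow> (x, y) \<in> R z"
      using class_ext by blast
    have new: "Inr w \<notin> \<mu>' ` (Z0 \<union> Z1)"
    proof
      assume "Inr w \<in> \<mu>' ` (Z0 \<union> Z1)"
      then have "w < B" using B by blast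
      then show False using w(1) by simp
    qed
    let ?\<mu> = "\<mu>'(z := Inr w)"
    have z: "z \<notin> Z0 \<union> Z1" using False insert by auto
    have "inj_on ?\<mu> (insert z (Z0 \<union> Z1))"
      using \<mu>'(2) new z by (rule inj_on_fun_upd_insert)
    moreover have "\<forall>z\<in>Z0. ?\<mu> z = \<mu> z"
      using \<mu>'(1) False by auto
    moreover have "\<forall>v\<in>insert z Z1 - Z0. \<exists>w. ?\<mu> v = Inr w \<and>
        (\<forall>y<N. \<forall>x<y. Inr w \<in> t x y \<longleftrightarrow> (x, y) \<in> R v)"
      using \<mu>'(3) w(2) by auto
    ultimately show ?thesis by (metis Un_insert_right)
  qed
qed

lemma color_map_extend:
  assumes "finite G" "finite F" "card F \<le> q" "\<And>u. u \<in> F \<Longrightarrow> valid u"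
    and "F0 \<subseteq> F" "inj_on \<theta> F0" "\<And>u. u \<in> F0 \<Longrightarrow> fst (\<theta> u) = \<mu> (fst u)"
      "\<And>u. u \<in> F0 \<Longrightarrow> valid (\<theta> u)"
    and "inj_on \<mu> (fst ` F)" "\<And>z n. z \<in> fst ` F \<Longrightarrow> n < q \<Longrightarrow> \<mu> z = Inl n \<Longrightarrow> z = Inl n"
  shows "G \<subseteq> F \<Longrightarrow> \<exists>\<theta>'. (\<forall>u\<in>F0. \<theta>' u = \<theta> u) \<and> inj_on \<theta>' (F0 \<union> G) \<and>
    (\<forall>u\<in>F0 \<union> G. fst (\<theta>' u) = \<mu> (fst u) \<and> valid (\<theta>' u))"
  using assms(1)
proof (induction rule: finite_induct)
  case empty
  then show ?case using assms by auto
next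
  case (insert u G)
  then obtain \<theta>' where \<theta>': "\<forall>u\<in>F0. \<theta>' u = \<theta> u" "inj_on \<theta>' (F0 \<union> G)"
    "\<forall>u\<in>F0 \<union> G. fst (\<theta>' u) = \<mu> (fst u) \<and> valid (\<theta>' u)"
    by blast
  show ?case
  proof (cases "u \<in> F0")
    case True
    then have "F0 \<union> insert u G = F0 \<union> G" by auto
    then show ?thesis using \<theta>' by metis
  next
    case False
    define H where "H = F0 \<union> G"
    have H: "H \<subseteq> F" "finite H" "u \<notin> H" "u \<in> F"
      using False insert assms(2,5) by (auto simp: H_def intro: finite_subset)
    have "\<exists>i. valid (\<mu> (fst u), i) \<and> (\<mu> (fst u), i) \<notin> \<theta>' ` H"
    proof (cases "\<mu> (fst u)")
      case (Inr w)
      have "finite (snd ` \<theta>' ` H)" using H by auto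
      then obtain i where "i \<notin> snd ` \<theta>' ` H"
        using ex_new_if_finite[OF infinite_UNIV_nat] by blast
      then have "(\<mu> (fst u), i) \<notin> \<theta>' ` H" by (metis image_eqI snd_conv)
      then show ?thesis using Inr by auto
    next
      case (Inl n)
      define H' where "H' = {v \<in> H. fst v = fst u}"
      have "card H' \<le> n"
      proof (cases "n < q")
        case True
        then have u: "fst u = Inl n"
          using assms(10) H(4) Inl by blast
        have "insert u H' \<subseteq> Pair (Inl n) ` {..n}"
        proof
          fix v assume "v \<in> insert u H'"
          then have "valid v" "fst v = Inl n"
            using u H assms(4)[of v] by (auto simp: H'_def)
          then show "v \<in> Pair (Inl n) ` {..n}" by (cases v) auto
        qed
        then have "card (insert u H') \<le> card (Pair (Inl n :: cls) ` {..n})"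
          by (intro card_mono) auto
        also have "\<dots> \<le> Suc n"
          using card_image_le[of "{..n}" "Pair (Inl n :: cls)"] by simp
        finally show ?thesis using H by (simp add: H'_def)
      next
        case False
        have "card (insert u H') \<le> card F"
          using H assms(2) by (intro card_mono) (auto simp: H'_def)
        then show ?thesis using H False assms(3) by (simp add: H'_def)
      qed
      moreover have "card (snd ` \<theta>' ` H') \<le> card H'"
        using H by (simp add: H'_def image_image card_image_le)
      ultimately have "card (snd ` \<theta>' ` H') < card {..n}" by simp
      then have "\<not> {..n} \<subseteq> snd ` \<theta>' ` H'"
        using H card_mono[of "snd ` \<theta>' ` H'" "{..n}"] by (auto simp: H'_def)
      then obtain i where i: "i \<le> n" "i \<notin> snd ` \<theta>' ` H'" by auto
      have "(\<mu> (fst u), i) \<notin> \<theta>' ` H"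
      proof
        assume "(\<mu> (fst u), i) \<in> \<theta>' ` H"
        then obtain v where v: "v \<in> H" "\<theta>' v = (\<mu> (fst u), i)" by auto
        then have "\<mu> (fst v) = \<mu> (fst u)"
          using \<theta>'(3) by (metis H_def fst_conv)
        then have "fst v = fst u"
          using assms(9) v H by (meson image_eqI inj_on_eq_iff subsetD)
        then have "i \<in> snd ` \<theta>' ` H'"
          using v by (force simp: H'_def)
        then show False using i by simp
      qed
      then show ?thesis using i Inl by auto
    qed
    then obtain i where i: "valid (\<mu> (fst u), i)" "(\<mu> (fst u), i) \<notin> \<theta>' ` H" by blast
    let ?\<theta> = "\<theta>'(u := (\<mu> (fst u), i))"
    have "inj_on ?\<theta> (insert u H)"
      using \<theta>'(2) i(2) H(3) unfolding H_def by (rule inj_on_fun_upd_insert)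
    moreover have "\<forall>u\<in>F0. ?\<theta> u = \<theta> u" using \<theta>'(1) False by auto
    moreover have "\<forall>v\<in>insert u H. fst (?\<theta> v) = \<mu> (fst v) \<and> valid (?\<theta> v)"
      using \<theta>'(3) i(1) H(3) by (auto simp: H_def)
    moreover have "F0 \<union> insert u G = insert u H" by (simp add: H_def)
    ultimately show ?thesis by metis
  qed
qed

text \<open>The back-and-forth step. Unless \<open>a\<close> is already a value, \<open>b\<close> is
  placed above all the \<open>s' i\<close>, wherever \<open>a\<close> lies among the
  \<open>s i\<close>. Cofiniteness below \<open>b\<close> does no harm, as it says nothing about the
  finitely many classes being tracked.\<close>

lemma equiv_on_extend:
  assumes fin: "finite V" and q: "card V * card V \<le> q" and x: "x \<in> V"
    and eq: "equiv_on V q s s'"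
  shows "\<exists>b. equiv_on V q (s(x := a)) (s'(x := b))"
proof -
  define W where "W = V - {x}"
  have W: "finite W" "x \<notin> W" "V = insert x W" using fin x by (auto simp: W_def)
  have eqW: "equiv_on W q s s'" using eq by (rule equiv_on_mono) (simp add: W_def)
  show ?thesis
  proof (cases "a \<in> s ` W")
    case True
    then obtain i where i: "i \<in> W" "a = s i" by blast
    have "s(x := a) = s \<circ> id(x := i)" "s'(x := s' i) = s' \<circ> id(x := i)"
      by (auto simp: i)
    moreover have "equiv_on V q (s \<circ> id(x := i)) (s' \<circ> id(x := i))"
      using eqW by (rule equiv_on_comp) (use i W in auto)
    ultimately show ?thesis by metis
  next
    case False
    \<comment> \<open>Positivity of \<open>q\<close> puts the class \<open>Inl 0\<close> of the
      diagonal colour among the small ones.\<close>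
    have "0 < card V * card V" using fin x by (auto simp: card_gt_0_iff)
    then have q0: "0 < q" using q by (rule less_le_trans)
    define S where "S = s(x := a)"
    have S: "S x = a" "\<And>i. i \<in> W \<Longrightarrow> S i = s i" using W by (auto simp: S_def)
    define F where "F = (\<lambda>(i, j). c (S i) (S j)) ` (V \<times> V)"
    define F0 where "F0 = (\<lambda>(i, j). c (s i) (s j)) ` (W \<times> W)"
    have F: "c (S i) (S j) \<in> F" if "i \<in> V" "j \<in> V" for i j
      using that by (auto simp: F_def)
    have finF: "finite F" using fin by (simp add: F_def)
    have "card F \<le> card (V \<times> V)"
      unfolding F_def by (rule card_image_le) (use fin in auto)
    then have cardF: "card F \<le> q" using q by (simp add: card_cartesian_product)
    have F0F: "F0 \<subseteq> F"
    proof
      fix u assume "u \<in> F0"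
      then obtain i j where "i \<in> W" "j \<in> W" "u = c (s i) (s j)" by (auto simp: F0_def)
      then show "u \<in> F" using F[of i j] S W by auto
    qed
    have F0_cases: "\<exists>i\<in>W. \<exists>j\<in>W. u = c (s i) (s j)" if "u \<in> F0" for u
      using that by (auto simp: F0_def)
    have validF: "valid u" if "u \<in> F" for u using that c_valid by (auto simp: F_def)

    \<comment> \<open>The old vertices determine partial maps: \<open>\<phi>\<close> leads back from
      the right-hand vertices to the left-hand ones, while \<open>\<theta>\<close> and
      \<open>\<mu>1\<close> carry colours and classes from left to right.\<close>
    obtain \<phi> where \<phi>: "\<And>i. i \<in> W \<Longrightarrow> \<phi> (s' i) = s i"
      by (rule factor_through[of W s' s]) (use equiv_onD(1)[OF eqW] in blast)+
    obtain \<theta> where \<theta>: "\<And>i j. i \<in> W \<Longrightarrow> j \<in> W \<Longrightarrow> \<theta> (c (s i) (s j)) = c (s' i) (s' j)"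
      by (rule factor_through2[of W "\<lambda>i j. c (s i) (s j)" "\<lambda>i j. c (s' i) (s' j)"])
        (use equiv_onD(4)[OF eqW] in blast)+
    obtain \<mu>1 where \<mu>1: "\<And>i j. i \<in> W \<Longrightarrow> j \<in> W \<Longrightarrow>
        \<mu>1 (fst (c (s i) (s j))) = fst (c (s' i) (s' j))"
      by (rule factor_through2[of W "\<lambda>i j. fst (c (s i) (s j))" "\<lambda>i j. fst (c (s' i) (s' j))"])
        (use equiv_onD(5)[OF eqW] in blast)+

    define small :: "cls set" where "small = Inl ` {..<q}"
    define Z0 where "Z0 = small \<union> fst ` F0"
    define Z where "Z = Z0 \<union> fst ` F"
    \<comment> \<open>Fixing the small classes is consistent with \<open>\<mu>1\<close> on occurring
      classes, because \<open>equiv_on\<close> compares small classes by name.\<close>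
    define \<mu>0 where "\<mu>0 z = (if z \<in> small then z else \<mu>1 z)" for z
    have Z0_cases: "\<exists>i\<in>W. \<exists>j\<in>W. z = fst (c (s i) (s j))" if "z \<in> Z0" "z \<notin> small" for z
    proof -
      have "z \<in> fst ` F0" using that by (simp add: Z0_def)
      then obtain u where "u \<in> F0" "z = fst u" by (rule imageE)
      then show ?thesis using F0_cases[of u] by blast
    qed
    have small_iff: "fst (c (s i) (s j)) = z \<longleftrightarrow> fst (c (s' i) (s' j)) = z"
      if "i \<in> W" "j \<in> W" "z \<in> small" for i j z
      using equiv_onD(3)[OF eqW that(1,2)] that(3) by (auto simp: small_def)
    have \<mu>0: "\<mu>0 (fst (c (s i) (s j))) = fst (c (s' i) (s' j))" if "i \<in> W" "j \<in> W" for i j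
      using small_iff[OF that, of "fst (c (s i) (s j))"] \<mu>1[OF that] by (simp add: \<mu>0_def)
    have inj0: "inj_on \<mu>0 Z0"
    proof (rule inj_onI)
      fix u v assume uv: "u \<in> Z0" "v \<in> Z0" "\<mu>0 u = \<mu>0 v"
      have *: "u = v" if u: "u \<in> small" and v: "v \<in> Z0" and e: "\<mu>0 u = \<mu>0 v" for u v
      proof (cases "v \<in> small")
        case False
        then obtain i j where ij: "i \<in> W" "j \<in> W" "v = fst (c (s i) (s j))"
          using v Z0_cases by blast
        then have "fst (c (s' i) (s' j)) = u"
          using \<mu>0 e u by (auto simp: \<mu>0_def)
        then show ?thesis using small_iff[OF ij(1,2) u] ij(3) by simp
      qed (use u e in \<open>simp add: \<mu>0_def\<close>)
      show "u = v"
      proof (cases "u \<in> small \<or> v \<in> small")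
        case True
        then show ?thesis using *[of u v] *[of v u] uv by auto
      next
        case False
        then obtain i j k l where ij: "i \<in> W" "j \<in> W" "u = fst (c (s i) (s j))"
          and kl: "k \<in> W" "l \<in> W" "v = fst (c (s k) (s l))"
          using uv(1,2) Z0_cases by metis
        then have "fst (c (s' i) (s' j)) = fst (c (s' k) (s' l))"
          using uv(3) \<mu>0 by simp
        then show ?thesis
          using equiv_onD(5)[OF eqW ij(1,2) kl(1,2)] ij(3) kl(3) by simp
      qed
    qed
    obtain N0 where N0: "\<And>i. i \<in> W \<Longrightarrow> s' i < N0"
      using finite_nat_set_iff_bounded[of "s' ` W"] W by auto
    have "finite Z0" using F0F finF by (auto simp: Z0_def small_def intro: finite_subset)
    \<comment> \<open>A class that enters only through \<open>a\<close>, and is not small, goes to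
      an infinite class whose tournament on the vertices \<open>s' i\<close> is copied through
      \<open>\<phi>\<close>.\<close>
    have "\<exists>\<mu>. (\<forall>z\<in>Z0. \<mu> z = \<mu>0 z) \<and> inj_on \<mu> Z \<and> (\<forall>z\<in>fst ` F - Z0.
        \<exists>w. \<mu> z = Inr w \<and> (\<forall>y<N0. \<forall>x<y. Inr w \<in> t x y \<longleftrightarrow> z \<in> t (\<phi> x) (\<phi> y)))"
      using class_map_extend[OF finite_imageI[OF finF] \<open>finite Z0\<close> inj0, of fst N0
          "\<lambda>z. {(u, v). z \<in> t (\<phi> u) (\<phi> v)}"]
      by (simp add: Z_def)
    then obtain \<mu> where \<mu>_all: "\<forall>z\<in>Z0. \<mu> z = \<mu>0 z" and \<mu>_inj: "inj_on \<mu> Z"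
      and new: "\<forall>z\<in>fst ` F - Z0.
        \<exists>w. \<mu> z = Inr w \<and> (\<forall>y<N0. \<forall>x<y. Inr w \<in> t x y \<longleftrightarrow> z \<in> t (\<phi> x) (\<phi> y))"
      by (elim exE conjE)
    have \<mu>: "\<And>z. z \<in> Z0 \<Longrightarrow> \<mu> z = \<mu>0 z" "inj_on \<mu> Z" using \<mu>_all \<mu>_inj by simp_all
    have \<mu>_small: "\<mu> (Inl n) = Inl n" "Inl n \<in> Z" if "n < q" for n
      using that \<mu>(1)[of "Inl n"] by (auto simp: Z_def Z0_def small_def \<mu>0_def)
    have \<mu>_c: "\<mu> (fst (c (s i) (s j))) = fst (c (s' i) (s' j))" if "i \<in> W" "j \<in> W" for i j
      using \<mu>(1)[of "fst (c (s i) (s j))"] \<mu>0[OF that] that by (force simp: Z0_def F0_def)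
    have "\<exists>\<theta>'. (\<forall>u\<in>F0. \<theta>' u = \<theta> u) \<and> inj_on \<theta>' (F0 \<union> F) \<and>
      (\<forall>u\<in>F0 \<union> F. fst (\<theta>' u) = \<mu> (fst u) \<and> valid (\<theta>' u))"
    proof (rule color_map_extend[OF finF finF cardF validF F0F])
      show "inj_on \<theta> F0"
      proof (rule inj_onI)
        fix u v assume uv: "u \<in> F0" "v \<in> F0" "\<theta> u = \<theta> v"
        then obtain i j k l where "i \<in> W" "j \<in> W" "u = c (s i) (s j)"
          "k \<in> W" "l \<in> W" "v = c (s k) (s l)"
          using F0_cases by metis
        then show "u = v"
          using equiv_onD(4)[OF eqW] \<theta> uv(3) by metis
      qed
      show "fst (\<theta> u) = \<mu> (fst u)" if "u \<in> F0" for u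
        using F0_cases[OF that] \<theta> \<mu>_c by force
      show "valid (\<theta> u)" if "u \<in> F0" for u
        using F0_cases[OF that] \<theta> c_valid by metis
      show "inj_on \<mu> (fst ` F)"
        using \<mu>(2) by (rule inj_on_subset) (simp add: Z_def)
      show "z = Inl n" if "z \<in> fst ` F" "n < q" "\<mu> z = Inl n" for z n
        using \<mu>_small[OF that(2)] \<mu>(2) that by (metis UnI2 Z_def inj_on_eq_iff)
    qed auto
    then obtain \<theta>' where \<theta>': "\<And>u. u \<in> F0 \<Longrightarrow> \<theta>' u = \<theta> u" "inj_on \<theta>' F"
      "\<And>u. u \<in> F \<Longrightarrow> fst (\<theta>' u) = \<mu> (fst u)" "\<And>u. u \<in> F \<Longrightarrow> valid (\<theta>' u)"
      using F0F by (metis sup.absorb2)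

    have finZ: "finite Z" using \<open>finite Z0\<close> finF by (simp add: Z_def)
    have "finite (Inr -` \<mu> ` Z)"
      using finZ by (intro finite_vimageI) auto
    then obtain N1 where N1: "\<And>w. Inr w \<in> \<mu> ` Z \<Longrightarrow> w < N1"
      using finite_nat_set_iff_bounded by (metis vimageI2)
    define k where "k y = (if y \<in> s' ` W then \<theta>' (c (\<phi> y) a) else (Inl 0, 0))" for y
    \<comment> \<open>Finite classes outside the tracked images are all included, which gives the
      cofiniteness that \<open>vertex_ext\<close> demands. Tracked infinite classes have indices
      below \<open>N1\<close>, so \<open>vertex_ext\<close> decides them.\<close>
    define D where "D y = \<mu> ` (Z \<inter> t (\<phi> y) a) \<union> (range Inl - \<mu> ` Z)" for y
    have "valid (k y)" for y
    proof (cases "y \<in> s' ` W")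
      case True
      then obtain i where "i \<in> W" "y = s' i" by auto
      then show ?thesis using \<theta>'(4) F[of i x] S W \<phi> by (auto simp: k_def)
    qed (simp add: k_def)
    moreover have "finite {n. Inl n \<notin> D y}" for y
    proof (rule finite_subset)
      show "{n. Inl n \<notin> D y} \<subseteq> Inl -` \<mu> ` Z" by (auto simp: D_def)
      show "finite (Inl -` \<mu> ` Z)" using finZ by (intro finite_vimageI) auto
    qed
    ultimately obtain b where b: "b \<ge> max N0 N1" "\<And>y. y < max N0 N1 \<Longrightarrow> c y b = k y"
      "\<And>y n. y < max N0 N1 \<Longrightarrow> Inl n \<in> t y b \<longleftrightarrow> Inl n \<in> D y"
      "\<And>y z. y < max N0 N1 \<Longrightarrow> z < max N0 N1 \<Longrightarrow> Inr z \<in> t y b \<longleftrightarrow> Inr z \<in> D y"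
      using vertex_ext[of k D "max N0 N1"] by blast
    have sb: "s' i < b" if "i \<in> W" for i using N0[OF that] b(1) by simp
    have cb: "c (s' i) b = \<theta>' (c (s i) a)" if "i \<in> W" for i
      using b(2)[of "s' i"] N0[OF that] that \<phi> by (auto simp: k_def)
    have tb: "\<mu> z \<in> t (s' i) b \<longleftrightarrow> z \<in> t (s i) a" if "i \<in> W" "z \<in> Z" for i z
    proof -
      have "\<mu> z \<in> t (s' i) b \<longleftrightarrow> \<mu> z \<in> D (s' i)"
      proof -
        have i: "s' i < max N0 N1" using N0[OF that(1)] by simp
        have "\<mu> z \<in> \<mu> ` Z" using that(2) by simp
        then show ?thesis
          using b(3)[OF i] b(4)[OF i] N1 by (cases "\<mu> z") (simp_all add: less_max_iff_disj)
      qed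
      also have "\<dots> \<longleftrightarrow> z \<in> t (s i) a"
      proof -
        have "\<mu> z \<in> \<mu> ` (Z \<inter> t (s i) a) \<longleftrightarrow> z \<in> Z \<inter> t (s i) a"
          using \<mu>(2) that(2) by (rule inj_on_image_mem_iff) simp
        then show ?thesis using that \<phi>[OF that(1)] by (simp add: D_def)
      qed
      finally show ?thesis .
    qed
    have tW: "\<mu> z \<in> t (s' i) (s' j) \<longleftrightarrow> z \<in> t (s i) (s j)" if "i \<in> W" "j \<in> W" "z \<in> Z" for i j z
    proof (cases "z \<in> Z0")
      case True
      then consider "z \<in> small" | k l where "k \<in> W" "l \<in> W" "z = fst (c (s k) (s l))"
        using Z0_cases by blast
      then show ?thesis
      proof cases
        case 1
        then obtain n where "n < q" "z = Inl n" by (auto simp: small_def)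
        then show ?thesis using equiv_onD(2)[OF eqW that(1,2)] \<mu>_small by simp
      next
        case (2 k l)
        then show ?thesis using equiv_onD(6)[OF eqW that(1,2)] \<mu>_c by metis
      qed
    next
      case False
      then obtain w where w: "\<mu> z = Inr w"
        "\<And>u v. u < v \<Longrightarrow> v < N0 \<Longrightarrow> Inr w \<in> t u v \<longleftrightarrow> z \<in> t (\<phi> u) (\<phi> v)"
        using bspec[OF new, of z] \<open>z \<in> Z\<close> by (auto simp: Z_def)
      \<comment> \<open>The choice of \<open>w\<close> covers only pairs that increase on the right;
        the other pairs follow from \<open>t_flip\<close> and \<open>t_diag\<close>.\<close>
      have *: "\<mu> z \<in> t (s' i) (s' j) \<longleftrightarrow> z \<in> t (s i) (s j)"
        if "i \<in> W" "j \<in> W" "s' i < s' j" for i j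
        using w that N0 \<phi> by simp
      have s: "s i = s j \<longleftrightarrow> s' i = s' j"
        using equiv_onD(1)[OF eqW that(1,2)] .
      show ?thesis
      proof (cases "s' i" "s' j" rule: linorder_cases)
        case less
        then show ?thesis using * that by blast
      next
        case equal
        then show ?thesis using s t_diag by simp
      next
        case greater
        then show ?thesis
          using *[of j i] that s t_flip[of "s' j" "s' i"] t_flip[of "s j" "s i"] by auto
      qed
    qed
    define S' where "S' = s'(x := b)"
    have S': "S' x = b" "\<And>i. i \<in> W \<Longrightarrow> S' i = s' i" using W by (auto simp: S'_def)
    \<comment> \<open>The diagonal colour is the only valid one in its class, and
      \<open>\<mu>\<close> fixes that class.\<close>
    have \<theta>'_diag: "\<theta>' (Inl 0, 0) = (Inl 0, 0)"
    proof -
      have "(Inl 0, 0) \<in> F" using F[of x x] x c_diag by simp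
      then have "fst (\<theta>' (Inl 0, 0)) = Inl 0" "valid (\<theta>' (Inl 0, 0))"
        using \<theta>' \<mu>_small q0 by auto
      then show ?thesis by (cases "\<theta>' (Inl 0, 0)") auto
    qed
    have "equiv_on V q S S'"
    proof (rule equiv_on_transport[where \<theta> = \<theta>' and \<mu> = \<mu> and F = F and Z = Z])
      show "S i = S j \<longleftrightarrow> S' i = S' j" if "i \<in> V" "j \<in> V" for i j
        using that W(3) S S' False sb equiv_onD(1)[OF eqW]
        by (metis image_eqI insertE less_irrefl)
      show "c (S' i) (S' j) = \<theta>' (c (S i) (S j))" if "i \<in> V" "j \<in> V" for i j
      proof -
        have "c (s' i) (s' j) = \<theta>' (c (s i) (s j))" if "i \<in> W" "j \<in> W" for i j
        proof -
          have "(\<lambda>(i, j). c (s i) (s j)) (i, j) \<in> F0"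
            unfolding F0_def using that by (intro imageI) simp
          then show ?thesis using \<theta>'(1) \<theta>[OF that] by simp
        qed
        then show ?thesis
          using that W(3) S S' cb c_sym c_diag \<theta>'_diag by (metis insertE)
      qed
      show "\<mu> z \<in> t (S' i) (S' j) \<longleftrightarrow> z \<in> t (S i) (S j)" if "i \<in> V" "j \<in> V" "z \<in> Z" for i j z
      proof -
        have "\<mu> z \<in> t b (s' i) \<longleftrightarrow> z \<in> t a (s i)" if "i \<in> W" for i
          using tb[OF that \<open>z \<in> Z\<close>] sb[OF that] False that t_flip[of "s' i" b] t_flip[of "s i" a]
          by auto
        then show ?thesis
          using that W(3) S S' tb tW t_diag by (metis insertE empty_iff)
      qed
      show "fst ` F \<subseteq> Z" by (simp add: Z_def)
      show "Inl ` {..<q} \<subseteq> Z" using \<mu>_small(2) by blast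
    qed (fact F \<theta>'(2,3) \<mu>(2) \<mu>_small(1))+
    then show ?thesis unfolding S_def S'_def by blast
  qed
qed

text \<open>The quantifier case is the extension lemma. Since all variables stay in
  \<open>V\<close>, at most \<open>card V * card V\<close> colours occur at any time, and the same
  \<open>q\<close> serves at every quantifier depth.\<close>

lemma sat_equiv_on:
  assumes fin: "finite V" and q: "card V * card V \<le> q"
  shows "formula_of coloring_language p \<Longrightarrow> vars p \<subseteq> V \<Longrightarrow> equiv_on V q s s' \<Longrightarrow>
    sat coloring_struct s p \<longleftrightarrow> sat coloring_struct s' p"
proof (induction p arbitrary: s s')
  case (Eq x y)
  then show ?case by (auto simp: equiv_on_def)
next
  case (Rel r xs)
  then obtain i j k l where xs: "xs = [i, j, k, l]"
    by (auto simp: coloring_language_def length_Suc_conv numeral_eq_Suc)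
  then show ?case
    using Rel unfolding equiv_on_def by (simp add: coloring_struct_def coloring_rel_def)
next
  case (Exi x p)
  \<comment> \<open>One direction suffices, as \<open>equiv_on\<close> is symmetric.\<close>
  have "sat coloring_struct s' (Exi x p)"
    if sat: "sat coloring_struct s (Exi x p)" and eq: "equiv_on V q s s'" for s s'
  proof -
    obtain a where "sat coloring_struct (s(x := a)) p" using sat by auto
    moreover have "x \<in> V" using Exi.prems by simp
    from equiv_on_extend[OF fin q this eq, of a]
    obtain b where "equiv_on V q (s(x := a)) (s'(x := b))" by blast
    ultimately have "sat coloring_struct (s'(x := b)) p" using Exi by auto
    then show ?thesis by (auto simp: coloring_struct_def)
  qed
  then show ?case using Exi.prems equiv_on_sym by blast
qed auto

section \<open>Rigidity\<close>

lemma c_surj: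
  assumes "valid u"
  obtains x y where "c x y = u"
proof -
  obtain y where "c 0 y = u"
    using vertex_ext[of "\<lambda>_. u" "\<lambda>_. UNIV" 1] assms by auto
  then show thesis using that by blast
qed

text \<open>Sizes separate the finite classes from one another and, since \<open>card\<close> of an
  infinite set is \<open>0\<close>, from the infinite ones.\<close>

lemma card_class:
  "card {u. valid u \<and> fst u = q} = (case q of Inl n \<Rightarrow> Suc n | Inr _ \<Rightarrow> 0)"
proof (cases q)
  case (Inl n)
  then have "{u. valid u \<and> fst u = q} = Pair q ` {..n}" by auto
  then show ?thesis using Inl by (simp add: card_image inj_on_def)
next
  case (Inr z)
  then have "{u. valid u \<and> fst u = q} = range (Pair q)" by auto
  moreover have "infinite (range (Pair q :: nat \<Rightarrow> _))"
    by (intro range_inj_infinite) (simp add: inj_on_def)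
  ultimately show ?thesis using Inr by simp
qed

text \<open>Reversing a pair complements its set of classes, and a set of numbers and its complement
  are not both finite; on the diagonal no class occurs at all.\<close>

lemma less_iff_cofinite: "x < y \<longleftrightarrow> finite {n. Inl n \<notin> t x y}"
proof (cases "x < y")
  case False
  have "infinite {n. Inl n \<notin> t x y}"
  proof (cases "x = y")
    case True
    then show ?thesis by (simp add: t_diag)
  next
    case neq: False
    then have "finite {n. Inl n \<in> t x y}"
      using False t_cofinite[of y x] t_flip[of x y] by simp
    moreover have "UNIV = {n. Inl n \<in> t x y} \<union> {n. Inl n \<notin> t x y}" by auto
    ultimately show ?thesis by (metis finite_Un infinite_UNIV_nat)
  qed
  then show ?thesis using False by simp
qed (simp add: t_cofinite)

lemma rigid_coloring: "rigid coloring_language coloring_struct"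
  unfolding rigid_def
proof (intro allI impI ballI)
  fix f x assume f: "automorphism coloring_language coloring_struct f"
  then have bij: "bij f"
    by (simp add: isomorphism_def coloring_struct_def)
  have rel: "[x, y, z, w] \<in> coloring_rel r \<longleftrightarrow> [f x, f y, f z, f w] \<in> coloring_rel r"
    if "r \<in> {0, 1, 2}" for r x y z w
  proof -
    have "\<forall>xs. length xs = 4 \<longrightarrow> xs \<in> coloring_rel r \<longleftrightarrow> map f xs \<in> coloring_rel r"
      using f that unfolding isomorphism_def coloring_language_def coloring_struct_def tuples_def
      by auto
    from this[rule_format, of "[x, y, z, w]"] show ?thesis by simp
  qed
  have eq: "c x y = c z w \<longleftrightarrow> c (f x) (f y) = c (f z) (f w)"
    and cls: "fst (c x y) = fst (c z w) \<longleftrightarrow> fst (c (f x) (f y)) = fst (c (f z) (f w))"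
    and t: "fst (c z w) \<in> t x y \<longleftrightarrow> fst (c (f z) (f w)) \<in> t (f x) (f y)" for x y z w
    using rel[of 0 x y z w] rel[of 1 x y z w] rel[of 2 x y z w]
    by (simp_all only: coloring_rel_iff insert_iff simp_thms)
  \<comment> \<open>An automorphism induces a bijection \<open>g\<close> from the colours of a class
    onto those of the image class; by \<open>c_surj\<close> each valid colour is represented by a
    pair. Hence it fixes every class of finite size.\<close>
  have size: "card {u. valid u \<and> fst u = fst (c x y)} =
      card {u. valid u \<and> fst u = fst (c (f x) (f y))}" for x y
  proof -
    have C: "{u. valid u \<and> fst u = q} = {c x y | x y. fst (c x y) = q}" for q
    proof (intro equalityI subsetI)
      fix u assume "u \<in> {u. valid u \<and> fst u = q}"
      moreover from this obtain x y where "c x y = u" using c_surj by blast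
      ultimately show "u \<in> {c x y | x y. fst (c x y) = q}" by auto
    next
      fix u assume "u \<in> {c x y | x y. fst (c x y) = q}"
      then obtain x y where "u = c x y" "fst (c x y) = q" by blast
      then show "u \<in> {u. valid u \<and> fst u = q}" by (simp add: c_valid)
    qed
    have "\<exists>g. \<forall>x y. g (c x y) = c (f x) (f y)"
    proof (rule factor_through2[of UNIV c "\<lambda>x y. c (f x) (f y)"])
      show "c (f x) (f y) = c (f x') (f y')" if "c x y = c x' y'" for x y x' y'
        using that eq[of x y x' y'] by simp
      show "\<exists>g. \<forall>x y. g (c x y) = c (f x) (f y)"
        if "\<And>x y. x \<in> UNIV \<Longrightarrow> y \<in> UNIV \<Longrightarrow> g (c x y) = c (f x) (f y)" for g
        using that by (intro exI[of _ g]) simp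
    qed
    then obtain g where g: "\<And>x y. g (c x y) = c (f x) (f y)" by blast
    have "bij_betw g {u. valid u \<and> fst u = fst (c x y)}
        {u. valid u \<and> fst u = fst (c (f x) (f y))}"
      unfolding C bij_betw_def
    proof
      show "inj_on g {c z w | z w. fst (c z w) = fst (c x y)}"
      proof (rule inj_onI)
        fix u v assume "u \<in> {c z w | z w. fst (c z w) = fst (c x y)}"
          "v \<in> {c z w | z w. fst (c z w) = fst (c x y)}" and uv: "g u = g v"
        then obtain z w z' w' where "u = c z w" "v = c z' w'" by blast
        then show "u = v" using uv g eq[of z w z' w'] by simp
      qed
      show "g ` {c z w | z w. fst (c z w) = fst (c x y)} =
          {c z w | z w. fst (c z w) = fst (c (f x) (f y))}" (is "?l = ?r")
      proof
        show "?l \<subseteq> ?r"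
        proof
          fix u assume "u \<in> ?l"
          then obtain z w where "u = g (c z w)" "fst (c z w) = fst (c x y)" by blast
          then have "u = c (f z) (f w)" "fst (c (f z) (f w)) = fst (c (f x) (f y))"
            using g cls by auto
          then show "u \<in> ?r" by blast
        qed
        show "?r \<subseteq> ?l"
        proof
          fix u assume "u \<in> ?r"
          then obtain z w where "u = c z w" "fst (c z w) = fst (c (f x) (f y))" by blast
          moreover obtain z' w' where "z = f z'" "w = f w'"
            using bij by (metis bij_pointE)
          ultimately have "u = g (c z' w')" "fst (c z' w') = fst (c x y)"
            using g cls by auto
          then show "u \<in> ?l" by blast
        qed
      qed
    qed
    then show ?thesis by (rule bij_betw_same_card)
  qed
  have std: "fst (c (f x) (f y)) = Inl n" if "fst (c x y) = Inl n" for x y n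
    using size[of x y] that by (simp add: card_class split: sum.splits)
  have t_std: "Inl n \<in> t (f x) (f y) \<longleftrightarrow> Inl n \<in> t x y" for n x y
  proof -
    obtain z w where "c z w = (Inl n, 0)" using c_surj[of "(Inl n, 0)"] by auto
    then show ?thesis using t[of z w x y] std[of z w n] by simp
  qed
  have mono: "f x < f y \<longleftrightarrow> x < y" for x y
    by (simp add: less_iff_cofinite t_std)
  \<comment> \<open>All smaller vertices are fixed, so neither \<open>f x\<close> nor the preimage
    of \<open>x\<close> lies below \<open>x\<close>; by monotonicity they cannot both lie
    above.\<close>
  have "f x = x" for x
  proof (induction x rule: less_induct)
    case (less x)
    obtain y where y: "f y = x" using bij by (metis bij_pointE)
    have "\<not> y < x" using less[of y] y by auto
    moreover have "\<not> f x < x"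
      using less[of "f x"] mono[of "f x" x] by auto
    ultimately show ?case
      using mono[of x y] y by (metis linorder_neqE_nat)
  qed
  then show "f x = x" .
qed

section \<open>Elementary indivisibility\<close>

text \<open>This relativises \<open>vertex_ext\<close> to \<open>S\<close>: prescriptions concern
  only elements of \<open>S\<close> and are realised inside \<open>S\<close>. It is strong enough
  for the greedy embedding and weak enough to be found on one side of any partition.\<close>

definition full :: "nat set \<Rightarrow> bool" where
  "full S \<longleftrightarrow> (\<forall>N k D. (\<forall>x. valid (k x)) \<longrightarrow> (\<forall>x. finite {n. Inl n \<notin> D x}) \<longrightarrow>
     (\<exists>y\<in>S. y \<ge> N \<and> (\<forall>x\<in>S. x < N \<longrightarrow> c x y = k x \<and> (\<forall>n. Inl n \<in> t x y \<longleftrightarrow> Inl n \<in> D x) \<and>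
        (\<forall>z<N. Inr z \<in> t x y \<longleftrightarrow> Inr z \<in> D x))))"

lemma fullD:
  assumes "full S" "\<And>x. valid (k x)" "\<And>x. finite {n. Inl n \<notin> D x}"
  shows "\<exists>y\<in>S. y \<ge> N \<and> (\<forall>x\<in>S. x < N \<longrightarrow> c x y = k x \<and> (\<forall>n. Inl n \<in> t x y \<longleftrightarrow> Inl n \<in> D x) \<and>
    (\<forall>z<N. Inr z \<in> t x y \<longleftrightarrow> Inr z \<in> D x))"
  using assms(1)[unfolded full_def, THEN spec[of _ N], THEN spec[of _ k], THEN spec[of _ D]]
    assms(2,3) by blast

text \<open>If \<open>S\<close> omits a type over its part below \<open>N0\<close>, the vertices
  from \<open>N0\<close> on that realise this type avoid \<open>S\<close>. They form a full set,
  because the type leaves free how they relate to vertices from \<open>N0\<close> on.\<close>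

lemma full_or_full_complement: "full S \<or> (\<exists>S'. S' \<subseteq> - S \<and> full S')"
proof (cases "full S")
  case False
  then obtain N0 k0 D0 where k0: "\<And>x. valid (k0 x)" and D0: "\<And>x. finite {n. Inl n \<notin> D0 x}"
    and none: "\<not> (\<exists>y\<in>S. y \<ge> N0 \<and> (\<forall>x\<in>S. x < N0 \<longrightarrow> c x y = k0 x \<and>
      (\<forall>n. Inl n \<in> t x y \<longleftrightarrow> Inl n \<in> D0 x) \<and> (\<forall>z<N0. Inr z \<in> t x y \<longleftrightarrow> Inr z \<in> D0 x)))"
    unfolding full_def by blast
  define S' where "S' = {y. y \<ge> N0 \<and> (\<forall>x\<in>S. x < N0 \<longrightarrow> c x y = k0 x \<and>
      (\<forall>n. Inl n \<in> t x y \<longleftrightarrow> Inl n \<in> D0 x) \<and> (\<forall>z<N0. Inr z \<in> t x y \<longleftrightarrow> Inr z \<in> D0 x))}"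
  have "S' \<subseteq> - S" using none unfolding S'_def by blast
  moreover have "full S'"
    unfolding full_def
  proof (intro allI impI)
    fix N and k :: "nat \<Rightarrow> color" and D :: "nat \<Rightarrow> cls set"
    assume k: "\<forall>x. valid (k x)" and D: "\<forall>x. finite {n. Inl n \<notin> D x}"
    \<comment> \<open>The two prescriptions cannot conflict, since elements of \<open>S'\<close> are
      at least \<open>N0\<close>.\<close>
    define k' where "k' x = (if x < N0 then k0 x else k x)" for x
    define D' where "D' x = (if x < N0 then D0 x else D x)" for x
    have "\<And>x. valid (k' x)" "\<And>x. finite {n. Inl n \<notin> D' x}"
      using k D k0 D0 by (auto simp: k'_def D'_def)
    then obtain y where y: "y \<ge> max N N0" "\<And>x. x < max N N0 \<Longrightarrow> c x y = k' x \<and>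
        (\<forall>n. Inl n \<in> t x y \<longleftrightarrow> Inl n \<in> D' x) \<and> (\<forall>z<max N N0. Inr z \<in> t x y \<longleftrightarrow> Inr z \<in> D' x)"
      using vertex_ext[of k' D' "max N N0"] by blast
    have "y \<in> S'"
      using y by (auto simp: S'_def k'_def D'_def)
    moreover have "c x y = k x \<and> (\<forall>n. Inl n \<in> t x y \<longleftrightarrow> Inl n \<in> D x) \<and>
        (\<forall>z<N. Inr z \<in> t x y \<longleftrightarrow> Inr z \<in> D x)" if "x \<in> S'" "x < N" for x
    proof -
      have "\<not> x < N0" using that(1) by (simp add: S'_def)
      then show ?thesis using y(2)[of x] that(2) by (simp add: k'_def D'_def)
    qed
    ultimately show "\<exists>y\<in>S'. y \<ge> N \<and> (\<forall>x\<in>S'. x < N \<longrightarrow> c x y = k x \<and>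
        (\<forall>n. Inl n \<in> t x y \<longleftrightarrow> Inl n \<in> D x) \<and> (\<forall>z<N. Inr z \<in> t x y \<longleftrightarrow> Inr z \<in> D x))"
      using y(1) by (intro bexI[of _ y]) auto
  qed
  ultimately show ?thesis by blast
qed simp

text \<open>The embedding is built together with a renaming \<open>\<sigma>\<close> of the infinite
  classes. At stage \<open>m\<close>, first \<open>\<sigma> m\<close> is chosen so that its
  tournament copies that of \<open>Inr m\<close> on the earlier vertices; then \<open>h m\<close> is
  taken above \<open>\<sigma> m\<close>, where fullness decides all classes named so far.\<close>

lemma full_embedding:
  assumes S: "full S"
  obtains h \<sigma> where "strict_mono h" "range h \<subseteq> S" "strict_mono \<sigma>"
    "\<And>i j. c (h i) (h j) = map_prod (map_sum id \<sigma>) id (c i j)"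
    "\<And>i j z. map_sum id \<sigma> z \<in> t (h i) (h j) \<longleftrightarrow> z \<in> t i j"
proof -
  define Q where "Q h \<sigma> m \<longleftrightarrow> h m \<in> S \<and> (\<forall>i<m. h i < h m \<and> \<sigma> i < \<sigma> m) \<and>
    (\<forall>j<m. \<forall>i<j. Inr (\<sigma> m) \<in> t (h i) (h j) \<longleftrightarrow> Inr m \<in> t i j) \<and>
    (\<forall>i<m. c (h i) (h m) = map_prod (map_sum id \<sigma>) id (c i m) \<and>
      (\<forall>n. Inl n \<in> t (h i) (h m) \<longleftrightarrow> Inl n \<in> t i m) \<and>
      (\<forall>z\<le>m. Inr (\<sigma> z) \<in> t (h i) (h m) \<longleftrightarrow> Inr z \<in> t i m))"
    for h \<sigma> :: "nat \<Rightarrow> nat" and m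
  \<comment> \<open>By \<open>c_bound\<close> the colour of a pair \<open>i < m\<close> can involve
    only infinite classes below \<open>m\<close>, so stage \<open>m\<close> does not look
    ahead.\<close>
  have Q_cong: "Q h \<sigma> m \<longleftrightarrow> Q h' \<sigma>' m"
    if eq: "\<And>i. i \<le> m \<Longrightarrow> h i = h' i \<and> \<sigma> i = \<sigma>' i" for h \<sigma> h' \<sigma>' m
  proof -
    have "map_prod (map_sum id \<sigma>) id (c i m) = map_prod (map_sum id \<sigma>') id (c i m)"
      if "i < m" for i
      using c_bound[OF that] eq by (cases "c i m"; cases "fst (c i m)") auto
    then show ?thesis
      unfolding Q_def using eq by auto
  qed
  have ext: "\<exists>y z. Q (h(m := y)) (\<sigma>(m := z)) m" if prev: "\<And>j. j < m \<Longrightarrow> Q h \<sigma> j" for h \<sigma> m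
  proof -
    have mono: "h i < h j" "\<sigma> i < \<sigma> j" if "i < j" "j < m" for i j
      using prev[OF that(2)] that(1) by (auto simp: Q_def)
    have hS: "h i \<in> S" if "i < m" for i using prev[OF that] by (simp add: Q_def)
    have "inj_on h {..<m}" "inj_on \<sigma> {..<m}"
      by (intro linorder_inj_onI; use mono in fastforce)+
    then obtain \<phi> where \<phi>: "\<And>i. i < m \<Longrightarrow> \<phi> (h i) = i"
      by (metis lessThan_iff the_inv_into_f_f)
    obtain N0 where N0: "\<And>i. i < m \<Longrightarrow> h i < N0" "\<And>i. i < m \<Longrightarrow> \<sigma> i < N0"
      using finite_nat_set_iff_bounded[of "h ` {..<m} \<union> \<sigma> ` {..<m}"] by blast
    obtain z where z: "z \<ge> N0" "\<And>u v. u < v \<Longrightarrow> v < N0 \<Longrightarrow> Inr z \<in> t u v \<longleftrightarrow> Inr m \<in> t (\<phi> u) (\<phi> v)"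
      using class_ext[of N0 "{(u, v). Inr m \<in> t (\<phi> u) (\<phi> v)}"] by auto
    define I where "I = h ` {..<m}"
    define k where "k u = (if u \<in> I then map_prod (map_sum id \<sigma>) id (c (\<phi> u) m) else (Inl 0, 0))"
      for u
    \<comment> \<open>Finite classes are kept, and infinite classes above \<open>m\<close> are left
      to their own stages. \<open>UNIV\<close> is a default meeting the cofiniteness
      requirement.\<close>
    define D where "D u = (if u \<in> I then map_sum id (\<sigma>(m := z)) ` (t (\<phi> u) m \<inter> (range Inl \<union> Inr ` {..m}))
      else UNIV)" for u
    have "valid (map_prod (map_sum id \<sigma>) id u) = valid u" for u
      by (cases u; cases "fst u") auto
    then have "valid (k u)" for u by (simp add: k_def c_valid)
    moreover have "finite {n. Inl n \<notin> D u}" for u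
    proof (cases "u \<in> I")
      case True
      then have "\<phi> u < m" using \<phi> by (auto simp: I_def)
      then have "finite {n. Inl n \<notin> t (\<phi> u) m}" by (rule t_cofinite)
      then show ?thesis
        by (rule rev_finite_subset) (use True in \<open>force simp: D_def\<close>)
    qed (simp add: D_def)
    \<comment> \<open>The bound \<open>Suc z\<close> exceeds all earlier vertices and also
      \<open>z\<close>, so the tournament of the newly named class is decided too.\<close>
    ultimately obtain y where y: "y \<in> S" "y \<ge> Suc z"
      and match: "\<And>u. u \<in> S \<Longrightarrow> u < Suc z \<Longrightarrow> c u y = k u \<and> (\<forall>n. Inl n \<in> t u y \<longleftrightarrow> Inl n \<in> D u) \<and>
        (\<forall>w<Suc z. Inr w \<in> t u y \<longleftrightarrow> Inr w \<in> D u)"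
      using fullD[OF S, of k D "Suc z"] by blast
    have "Q (h(m := y)) (\<sigma>(m := z)) m"
      unfolding Q_def
    proof (intro conjI allI impI)
      show "(h(m := y)) m \<in> S" using y by simp
      fix i assume i: "i < m"
      show "(h(m := y)) i < (h(m := y)) m" "(\<sigma>(m := z)) i < (\<sigma>(m := z)) m"
        using N0[OF i] i y z by auto
    next
      fix i j assume "j < m" "i < j"
      then show "Inr ((\<sigma>(m := z)) m) \<in> t ((h(m := y)) i) ((h(m := y)) j) \<longleftrightarrow> Inr m \<in> t i j"
        using z(2)[of "h i" "h j"] mono[of i j] N0 \<phi> by simp
    next
      fix i assume i: "i < m"
      have hi: "h i \<in> S" "h i < Suc z" "h i \<in> I" "\<phi> (h i) = i"
        using hS[OF i] N0(1)[OF i] z(1) \<phi>[OF i] i by (auto simp: I_def)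
      have "map_prod (map_sum id \<sigma>) id (c i m) = map_prod (map_sum id (\<sigma>(m := z))) id (c i m)"
        using c_bound[OF i, of m] by (cases "c i m"; cases "fst (c i m)") auto
      then show "c ((h(m := y)) i) ((h(m := y)) m) = map_prod (map_sum id (\<sigma>(m := z))) id (c i m)"
        using match[OF hi(1,2)] hi i by (simp add: k_def)
      show "Inl n \<in> t ((h(m := y)) i) ((h(m := y)) m) \<longleftrightarrow> Inl n \<in> t i m" for n
      proof -
        have "Inl n \<in> D (h i) \<longleftrightarrow> Inl n \<in> t i m"
          using hi by (force simp: D_def)
        then show ?thesis using match[OF hi(1,2)] i by simp
      qed
      fix w assume w: "w \<le> m"
      have "inj_on (\<sigma>(m := z)) (insert m {..<m})"
        using \<open>inj_on \<sigma> {..<m}\<close> by (rule inj_on_fun_upd_insert) (use N0(2) z(1) in force)+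
      then have inj: "inj_on (\<sigma>(m := z)) {..m}"
        by (simp add: lessThan_Suc_atMost[symmetric] lessThan_Suc)
      have "(\<sigma>(m := z)) w < Suc z" using N0(2)[of w] z(1) w by auto
      then have "Inr ((\<sigma>(m := z)) w) \<in> t (h i) y \<longleftrightarrow> Inr ((\<sigma>(m := z)) w) \<in> D (h i)"
        using match[OF hi(1,2)] by blast
      also have "\<dots> \<longleftrightarrow> (\<exists>v\<le>m. Inr v \<in> t i m \<and> (\<sigma>(m := z)) v = (\<sigma>(m := z)) w)"
      proof
        assume "Inr ((\<sigma>(m := z)) w) \<in> D (h i)"
        then obtain a where a: "a \<in> t i m" "a \<in> range Inl \<union> Inr ` {..m}"
          "Inr ((\<sigma>(m := z)) w) = map_sum id (\<sigma>(m := z)) a"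
          unfolding D_def using hi(3,4) by auto
        then show "\<exists>v\<le>m. Inr v \<in> t i m \<and> (\<sigma>(m := z)) v = (\<sigma>(m := z)) w"
          by (cases a) (auto simp del: fun_upd_apply)
      next
        assume "\<exists>v\<le>m. Inr v \<in> t i m \<and> (\<sigma>(m := z)) v = (\<sigma>(m := z)) w"
        then obtain v where v: "v \<le> m" "Inr v \<in> t i m" "(\<sigma>(m := z)) v = (\<sigma>(m := z)) w"
          by blast
        then have "Inr ((\<sigma>(m := z)) w) = map_sum id (\<sigma>(m := z)) (Inr v)"
          by (simp del: fun_upd_apply)
        moreover have "Inr v \<in> t i m \<inter> (range Inl \<union> Inr ` {..m})" using v by auto
        ultimately show "Inr ((\<sigma>(m := z)) w) \<in> D (h i)"
          unfolding D_def using hi(3,4) by (metis (no_types, lifting) image_eqI)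
      qed
      also have "\<dots> \<longleftrightarrow> Inr w \<in> t i m"
        using w inj by (metis atMost_iff inj_onD)
      finally show "Inr ((\<sigma>(m := z)) w) \<in> t ((h(m := y)) i) ((h(m := y)) m) \<longleftrightarrow> Inr w \<in> t i m"
        using i by simp
    qed
    then show ?thesis by blast
  qed
  \<comment> \<open>Overwriting the entries from \<open>m\<close> on by \<open>r\<close> makes the
    condition depend on \<open>f\<close> only below \<open>m\<close>, as the recursive choice
    requires.\<close>
  define P where "P f m r \<longleftrightarrow> Q (\<lambda>i. fst (if i < m then f i else r)) (\<lambda>i. snd (if i < m then f i else r)) m"
    for f :: "nat \<Rightarrow> nat \<times> nat" and m r
  have "\<exists>f. \<forall>m. P f m (f m)"
  proof (rule dependent_wellorder_choice)
    fix r and f g :: "nat \<Rightarrow> nat \<times> nat" and m :: nat assume "\<And>y. y < m \<Longrightarrow> f y = g y"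
    then have "(\<lambda>i. if i < m then f i else r) = (\<lambda>i. if i < m then g i else r)" by auto
    then show "P f m r = P g m r" by (simp only: P_def fun_eq_iff)
  next
    fix m :: nat and f :: "nat \<Rightarrow> nat \<times> nat" assume prev: "\<And>y. y < m \<Longrightarrow> P f y (f y)"
    have "Q (fst \<circ> f) (snd \<circ> f) j" if "j < m" for j
      using prev[OF that] unfolding P_def by (rule Q_cong[THEN iffD1, rotated]) auto
    then obtain y z where "Q ((fst \<circ> f)(m := y)) ((snd \<circ> f)(m := z)) m"
      using ext by blast
    then have "P f m (y, z)"
      unfolding P_def by (rule Q_cong[THEN iffD1, rotated]) auto
    then show "\<exists>r. P f m r" by blast
  qed
  then obtain f where f: "\<And>m. P f m (f m)" by blast
  define h where "h = fst \<circ> f"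
  define \<sigma> where "\<sigma> = snd \<circ> f"
  have Q: "Q h \<sigma> m" for m
    using f[of m] unfolding P_def h_def \<sigma>_def by (rule Q_cong[THEN iffD1, rotated]) auto
  have mono: "strict_mono h" "strict_mono \<sigma>"
    using Q by (auto simp: strict_mono_def Q_def)
  have c_less: "c (h i) (h j) = map_prod (map_sum id \<sigma>) id (c i j)" if "i < j" for i j
    using Q[of j] that by (simp add: Q_def)
  have t_less: "map_sum id \<sigma> z \<in> t (h i) (h j) \<longleftrightarrow> z \<in> t i j" if "i < j" for i j z
  proof (cases z)
    case (Inl n)
    then show ?thesis using Q[of j] that by (simp add: Q_def)
  next
    case (Inr w)
    \<comment> \<open>For \<open>w \<le> j\<close> this was settled when vertex \<open>j\<close> was
      chosen, otherwise when class \<open>w\<close> was named.\<close>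
    then show ?thesis
      using Q[of j] Q[of w] that by (cases "w \<le> j") (auto simp: Q_def)
  qed
  show thesis
  proof
    show "range h \<subseteq> S" using Q by (auto simp: Q_def)
    fix i j
    show "c (h i) (h j) = map_prod (map_sum id \<sigma>) id (c i j)"
      using c_less[of i j] c_less[of j i] c_sym[of i j] c_sym[of "h i" "h j"]
      by (cases i j rule: linorder_cases) (simp_all add: c_diag)
    fix z
    have "h i \<noteq> h j" if "i \<noteq> j"
      using mono(1) that by (simp add: strict_mono_eq)
    then show "map_sum id \<sigma> z \<in> t (h i) (h j) \<longleftrightarrow> z \<in> t i j"
      using t_less[of i j z] t_less[of j i z] t_flip[of "h j" "h i"] t_flip[of j i]
      by (cases i j rule: linorder_cases) (auto simp: t_diag)
  qed (fact mono)+
qed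

lemma elementarily_indivisible_coloring:
  "elementarily_indivisible coloring_language coloring_struct"
  unfolding elementarily_indivisible_def
proof
  fix col :: "nat \<Rightarrow> bool"
  let ?L = coloring_language and ?M = coloring_struct
  obtain S b where S: "full S" "\<And>x. x \<in> S \<Longrightarrow> col x = b"
    using full_or_full_complement[of "{x. col x}"] by blast
  obtain h \<sigma> where h: "strict_mono h" "range h \<subseteq> S" and \<sigma>: "strict_mono \<sigma>"
    and c: "\<And>i j. c (h i) (h j) = map_prod (map_sum id \<sigma>) id (c i j)"
    and t: "\<And>i j z. map_sum id \<sigma> z \<in> t (h i) (h j) \<longleftrightarrow> z \<in> t i j"
    using full_embedding[OF S(1)] by blast
  have inj_h: "inj h" using h(1) by (rule strict_mono_imp_inj_on)
  have inj_\<tau>: "inj (map_sum id \<sigma> :: cls \<Rightarrow> cls)"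
    using strict_mono_imp_inj_on[OF \<sigma>] by (auto intro: sum.inj_map)
  then have inj_c: "inj (map_prod (map_sum id \<sigma>) id :: color \<Rightarrow> color)"
    by (auto intro: prod.inj_map)
  define N where "N = \<lparr>univ = range h, interp = \<lambda>r. interp ?M r \<inter> tuples 4 (range h)\<rparr>"
  have sub: "substructure ?L N ?M"
    using structure_of_coloring
    by (auto simp: substructure_def structure_of_def N_def coloring_language_def coloring_struct_def)
  have iso: "isomorphism ?L ?M N h"
    unfolding isomorphism_def
  proof (intro conjI ballI)
    show "bij_betw h (univ ?M) (univ N)"
      using inj_h by (simp add: N_def coloring_struct_def bij_betw_def)
    fix r xs assume "r \<in> symbols ?L" "xs \<in> tuples (arity ?L r) (univ ?M)"
    then have r: "r \<in> {0, 1, 2}" and "length xs = 4"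
      by (auto simp: coloring_language_def tuples_def)
    then obtain x y z w where xs: "xs = [x, y, z, w]"
      by (auto simp: length_Suc_conv numeral_eq_Suc)
    have "fst (c (h x) (h y)) = map_sum id \<sigma> (fst (c x y))" for x y by (simp add: c)
    then have "[x, y, z, w] \<in> coloring_rel r \<longleftrightarrow> [h x, h y, h z, h w] \<in> coloring_rel r"
      using r by (auto simp: coloring_rel_iff[simplified] c t inj_eq[OF inj_c] inj_eq[OF inj_\<tau>])
    then show "xs \<in> interp ?M r \<longleftrightarrow> map h xs \<in> interp N r"
      by (simp add: xs N_def coloring_struct_def tuples_def)
  qed
  have "elementary_substructure ?L N ?M"
    unfolding elementary_substructure_def
  proof (intro conjI allI impI)
    fix p and s :: "nat \<Rightarrow> nat" assume p: "formula_of ?L p" and "range s \<subseteq> univ N"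
    then have s: "s = h \<circ> (inv h \<circ> s)"
      by (auto simp: N_def fun_eq_iff f_inv_into_f image_subset_iff)
    define s0 where "s0 = inv h \<circ> s"
    let ?q = "card (vars p) * card (vars p)"
    \<comment> \<open>The embedding acts injectively on all colours and classes and fixes every
      finite class, so an assignment and its image are equivalent for any bound.\<close>
    have "equiv_on (vars p) ?q s0 (h \<circ> s0)"
      by (rule equiv_on_transport[where \<theta> = "map_prod (map_sum id \<sigma>) id" and \<mu> = "map_sum id \<sigma>"
            and F = UNIV and Z = UNIV])
        (use inj_h inj_\<tau> inj_c in \<open>auto simp: c t inj_eq\<close>)
    then have "sat ?M s0 p \<longleftrightarrow> sat ?M (h \<circ> s0) p"
      by (intro sat_equiv_on[OF finite_vars order.refl p]) auto
    moreover have "sat N (h \<circ> s0) p \<longleftrightarrow> sat ?M s0 p"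
      by (rule sat_isomorphism[OF iso p]) (simp add: coloring_struct_def)
    ultimately show "sat N s p \<longleftrightarrow> sat ?M s p"
      using s by (simp add: s0_def)
  qed (fact sub)
  moreover have "monochromatic col N"
    using S(2) h(2) unfolding monochromatic_def N_def by (auto simp: image_subset_iff)
  moreover have "isomorphic ?L N ?M"
    using isomorphism_inv_into[OF iso] unfolding isomorphic_def by blast
  ultimately show "\<exists>N. substructure ?L N ?M \<and> monochromatic col N \<and> isomorphic ?L N ?M \<and>
      elementary_substructure ?L N ?M"
    using sub by blast
qed

end

theorem theorem3p2:
  shows "\<exists>(L :: nat language) (M :: (nat, nat) struct).
    finite_relational_language L \<and> structure_of L M \<and>
    countable (univ M) \<and> infinite (univ M) \<and>
    rigid L M \<and> elementarily_indivisible L M"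
proof -
  obtain c t where "generic_coloring c t" using exists_generic_coloring by blast
  then interpret generic_coloring c t .
  have "finite_relational_language coloring_language"
    by (simp add: finite_relational_language_def coloring_language_def)
  moreover have "univ coloring_struct = UNIV" by (simp add: coloring_struct_def)
  ultimately show ?thesis
    using structure_of_coloring rigid_coloring elementarily_indivisible_coloring
    by (intro exI[of _ coloring_language] exI[of _ coloring_struct]) auto
qed

end
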